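(* Let $(\mathcal{P},\mathcal{I})$ be a projective class in a triangulated category $\mathbb{T}$, and let \[ X \xrightarrow{\alpha} Y \xrightarrow{\beta} Z \xrightarrow{\gamma} \Sigma X \] be a triangle in $\mathbb{T}$, where $X$, $Y$ and $Z$ have finite lengths $k$, $n$ and $l$, respectively, and $\gamma \in \mathcal{I}^m$ with $m \le l$. Then \[ \mathrm{len}_{\mathcal{P}}(Y) = n \le \max(k-m+l,\,l). \]
   Context: A (stable) projective class in a triangulated category $\mathbb{T}$ consists of a class $\mathcal{P}$ of objects and a class $\mathcal{I}$ of morphisms such that: (i) $\mathcal{P}$ consists of exactly the objects $P$ such that every composite $P\to X\to Y$ is zero for each $X\to Y$ in $\mathcal{I}$; (ii) $\mathcal{I}$ consists of exactly the maps $X\to Y$ such that every composite $P\to X\to Y$ is zero for each $P\in\mathcal{P}$; (iii) for each $X$ in $\mathbb{T}$ there is a cofibre sequence (distinguished triangle) $P\to X\to Y$ with $P\in\mathcal{P}$ and $X\to Y$ in $\mathcal{I}$; and $\mathcal{P}$ (equivalently $\mathcal{I}$) is closed under suspension and desuspension. $\mathcal{I}^n$ ($n\ge 0$) is the ideal of all $n$-fold composites of maps in $\mathcal{I}$, with $\mathcal{I}^0$ all maps of $\mathbb{T}$. $\mathcal{P}_0$ consists of all zero objects, $\mathcal{P}_1=\mathcal{P}$, and $X\in\mathcal{P}_n$ iff $X$ is a retract of an object $M$ in a cofibre sequence $P\to M\to Q$ with $P\in\mathcal{P}$ and $Q\in\mathcal{P}_{n-1}$. Each $(\mathcal{P}_n,\mathcal{I}^n)$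 is a projective class. The length $\mathrm{len}_{\mathcal{P}}(X)$ is the smallest $n$ with $X\in\mathcal{P}_n$, if it exists (equivalently, the smallest $n$ such that every map in $\mathcal{I}^n$ with domain $X$ is zero). *)

theory Defs
  imports "HOL-Algebra.Group" "HOL-Library.Extended_Nat"
begin

section \<open>Additive categories\<close>

text \<open>The operations of a category are only meaningful on \<open>Ob\<close> and \<open>Ar\<close>;
  composition is written in the usual order, so \<open>g \<cdot> f\<close> is first \<open>f\<close>, then \<open>g\<close>.\<close>

record ('o, 'm) category =
  Ob :: "'o set"
  Ar :: "'m set"
  Dom :: "'m \<Rightarrow> 'o"
  Cod :: "'m \<Rightarrow> 'o"
  Ident :: "'o \<Rightarrow> 'm"
  Comp :: "'m \<Rightarrow> 'm \<Rightarrow> 'm"  (infixl "\<cdot>\<index>" 70)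

definition Hom :: "('o, 'm, 'x) category_scheme \<Rightarrow> 'o \<Rightarrow> 'o \<Rightarrow> 'm set" where
  "Hom C A B = {f \<in> Ar C. Dom C f = A \<and> Cod C f = B}"

definition is_iso :: "('o, 'm, 'x) category_scheme \<Rightarrow> 'o \<Rightarrow> 'o \<Rightarrow> 'm \<Rightarrow> bool" where
  "is_iso C A B f \<longleftrightarrow> f \<in> Hom C A B \<and>
     (\<exists>g \<in> Hom C B A. Comp C g f = Ident C A \<and> Comp C f g = Ident C B)"

definition is_retract :: "('o, 'm, 'x) category_scheme \<Rightarrow> 'o \<Rightarrow> 'o \<Rightarrow> bool" where
  "is_retract C X M \<longleftrightarrow>
     (\<exists>s \<in> Hom C X M. \<exists>r \<in> Hom C M X. Comp C r s = Ident C X)"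

definition zero_object :: "('o, 'm, 'x) category_scheme \<Rightarrow> 'o \<Rightarrow> bool" where
  "zero_object C N \<longleftrightarrow> N \<in> Ob C \<and>
     (\<forall>A \<in> Ob C. (\<exists>!f. f \<in> Hom C A N) \<and> (\<exists>!f. f \<in> Hom C N A))"

locale category =
  fixes C :: "('o, 'm, 'x) category_scheme" (structure)
  assumes dom_cod: "f \<in> Ar C \<Longrightarrow> Dom C f \<in> Ob C \<and> Cod C f \<in> Ob C"
    and ident_hom: "A \<in> Ob C \<Longrightarrow> Ident C A \<in> Hom C A A"
    and comp_hom: "\<lbrakk>f \<in> Hom C A B; g \<in> Hom C B D\<rbrakk> \<Longrightarrow> g \<cdot> f \<in> Hom C A D"
    and comp_ident: "f \<in> Hom C A B \<Longrightarrow> f \<cdot> Ident C A = f"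
    and ident_comp: "f \<in> Hom C A B \<Longrightarrow> Ident C B \<cdot> f = f"
    and comp_assoc: "\<lbrakk>f \<in> Hom C A B; g \<in> Hom C B D; h \<in> Hom C D E\<rbrakk>
      \<Longrightarrow> (h \<cdot> g) \<cdot> f = h \<cdot> (g \<cdot> f)"

record ('o, 'm) ab_category = "('o, 'm) category" +
  Zero :: "'o \<Rightarrow> 'o \<Rightarrow> 'm"
  Add :: "'m \<Rightarrow> 'm \<Rightarrow> 'm"  (infixl "\<boxplus>\<index>" 65)

definition HomGrp :: "('o, 'm, 'x) ab_category_scheme \<Rightarrow> 'o \<Rightarrow> 'o \<Rightarrow> 'm monoid" where
  "HomGrp C A B = \<lparr>carrier = Hom C A B, monoid.mult = Add C, one = Zero C A B\<rparr>"

definition Neg :: "('o, 'm, 'x) ab_category_scheme \<Rightarrow> 'm \<Rightarrow> 'm" where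
  "Neg C f = inv\<^bsub>HomGrp C (Dom C f) (Cod C f)\<^esub> f"

locale additive_category = category C
  for C :: "('o, 'm, 'x) ab_category_scheme" (structure) +
  assumes hom_comm_group: "\<lbrakk>A \<in> Ob C; B \<in> Ob C\<rbrakk> \<Longrightarrow> comm_group (HomGrp C A B)"
    and comp_add: "\<lbrakk>f \<in> Hom C A B; f' \<in> Hom C A B; g \<in> Hom C B D\<rbrakk>
      \<Longrightarrow> g \<cdot> (f \<boxplus> f') = (g \<cdot> f) \<boxplus> (g \<cdot> f')"
    and add_comp: "\<lbrakk>f \<in> Hom C A B; g \<in> Hom C B D; g' \<in> Hom C B D\<rbrakk>
      \<Longrightarrow> (g \<boxplus> g') \<cdot> f = (g \<cdot> f) \<boxplus> (g' \<cdot> f)"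
    and ex_zero_object: "\<exists>N. zero_object C N"
    and ex_biproduct: "\<lbrakk>A \<in> Ob C; B \<in> Ob C\<rbrakk> \<Longrightarrow>
      \<exists>S \<in> Ob C. \<exists>i \<in> Hom C A S. \<exists>j \<in> Hom C B S. \<exists>p \<in> Hom C S A. \<exists>q \<in> Hom C S B.
        p \<cdot> i = Ident C A \<and> q \<cdot> j = Ident C B \<and> (i \<cdot> p) \<boxplus> (j \<cdot> q) = Ident C S"


section \<open>Triangulated categories\<close>

record ('o, 'm) tri_category = "('o, 'm) ab_category" +
  Susp :: "'o \<Rightarrow> 'o"
  SuspMap :: "'m \<Rightarrow> 'm"
  Triangles :: "('m \<times> 'm \<times> 'm) set"

definition candidate ::
  "('o, 'm, 'x) tri_category_scheme \<Rightarrow> 'o \<Rightarrow> 'o \<Rightarrow> 'o \<Rightarrow> 'm \<Rightarrow> 'm \<Rightarrow> 'm \<Rightarrow> bool" where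
  "candidate C X Y Z f g h \<longleftrightarrow>
     f \<in> Hom C X Y \<and> g \<in> Hom C Y Z \<and> h \<in> Hom C Z (Susp C X)"

definition dist_triangle ::
  "('o, 'm, 'x) tri_category_scheme \<Rightarrow> 'o \<Rightarrow> 'o \<Rightarrow> 'o \<Rightarrow> 'm \<Rightarrow> 'm \<Rightarrow> 'm \<Rightarrow> bool" where
  "dist_triangle C X Y Z f g h \<longleftrightarrow> candidate C X Y Z f g h \<and> (f, g, h) \<in> Triangles C"

text \<open>The suspension is required to be an additive self-equivalence; the common convention that
  it is an automorphism is the special case in which it is bijective on objects.\<close>

locale triangulated_category = additive_category C
  for C :: "('o, 'm, 'x) tri_category_scheme" (structure) +
  assumes susp_ob: "A \<in> Ob C \<Longrightarrow> Susp C A \<in> Ob C"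
    and susp_ident: "A \<in> Ob C \<Longrightarrow> SuspMap C (Ident C A) = Ident C (Susp C A)"
    and susp_comp: "\<lbrakk>f \<in> Hom C A B; g \<in> Hom C B D\<rbrakk>
      \<Longrightarrow> SuspMap C (g \<cdot> f) = SuspMap C g \<cdot> SuspMap C f"
    and susp_add: "\<lbrakk>f \<in> Hom C A B; g \<in> Hom C A B\<rbrakk>
      \<Longrightarrow> SuspMap C (f \<boxplus> g) = SuspMap C f \<boxplus> SuspMap C g"
    and susp_fully_faithful: "\<lbrakk>A \<in> Ob C; B \<in> Ob C\<rbrakk>
      \<Longrightarrow> bij_betw (SuspMap C) (Hom C A B) (Hom C (Susp C A) (Susp C B))"
    and susp_ess_surj: "B \<in> Ob C \<Longrightarrow> \<exists>A \<in> Ob C. \<exists>u. is_iso C (Susp C A) B u"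
    and triangles_candidate: "(f, g, h) \<in> Triangles C \<Longrightarrow> \<exists>X Y Z. candidate C X Y Z f g h"
    and TR1_iso: "\<lbrakk>dist_triangle C X Y Z f g h; candidate C X' Y' Z' f' g' h';
      is_iso C X X' a; is_iso C Y Y' b; is_iso C Z Z' c;
      b \<cdot> f = f' \<cdot> a; c \<cdot> g = g' \<cdot> b; SuspMap C a \<cdot> h = h' \<cdot> c\<rbrakk>
      \<Longrightarrow> dist_triangle C X' Y' Z' f' g' h'"
    and TR1_ident: "\<lbrakk>X \<in> Ob C; zero_object C N\<rbrakk>
      \<Longrightarrow> dist_triangle C X X N (Ident C X) (Zero C X N) (Zero C N (Susp C X))"
    and TR1_cone: "f \<in> Hom C X Y \<Longrightarrow> \<exists>Z g h. dist_triangle C X Y Z f g h"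
    and TR2: "candidate C X Y Z f g h
      \<Longrightarrow> dist_triangle C X Y Z f g h \<longleftrightarrow> dist_triangle C Y Z (Susp C X) g h (Neg C (SuspMap C f))"
    and TR3: "\<lbrakk>dist_triangle C X Y Z f g h; dist_triangle C X' Y' Z' f' g' h';
      a \<in> Hom C X X'; b \<in> Hom C Y Y'; b \<cdot> f = f' \<cdot> a\<rbrakk>
      \<Longrightarrow> \<exists>c \<in> Hom C Z Z'. c \<cdot> g = g' \<cdot> b \<and> SuspMap C a \<cdot> h = h' \<cdot> c"
    and TR4: "\<lbrakk>dist_triangle C X Y U f p d; dist_triangle C Y Z W g r e; dist_triangle C X Z V (g \<cdot> f) q c\<rbrakk>
      \<Longrightarrow> \<exists>a b. dist_triangle C U V W a b (SuspMap C p \<cdot> e) \<and>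
        a \<cdot> p = q \<cdot> g \<and> c \<cdot> a = d \<and> b \<cdot> q = r \<and> e \<cdot> b = SuspMap C f \<cdot> c"


section \<open>Projective classes and length\<close>

text \<open>Since the suspension need not be surjective on objects, closure under desuspension is stated
  as: \<open>X\<close> is in \<open>P\<close> whenever its suspension is.\<close>

locale projective_class = triangulated_category C
  for C :: "('o, 'm, 'x) tri_category_scheme" (structure) +
  fixes P :: "'o set" and I :: "'m set"
  assumes projectives: "P = {A \<in> Ob C. \<forall>X Y. \<forall>f \<in> I \<inter> Hom C X Y. \<forall>p \<in> Hom C A X.
      f \<cdot> p = Zero C A Y}"
    and null_maps: "I = {f \<in> Ar C. \<forall>A \<in> P. \<forall>p \<in> Hom C A (Dom C f).
      f \<cdot> p = Zero C A (Cod C f)}"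
    and enough_projectives: "X \<in> Ob C
      \<Longrightarrow> \<exists>A \<in> P. \<exists>Y p f h. dist_triangle C A X Y p f h \<and> f \<in> I"
    and susp_closed: "X \<in> P \<Longrightarrow> Susp C X \<in> P"
    and desusp_closed: "\<lbrakk>X \<in> Ob C; Susp C X \<in> P\<rbrakk> \<Longrightarrow> X \<in> P"

fun ideal_pow :: "('o, 'm, 'x) category_scheme \<Rightarrow> 'm set \<Rightarrow> nat \<Rightarrow> 'm set" where
  "ideal_pow C I 0 = Ar C"
| "ideal_pow C I (Suc 0) = I"
| "ideal_pow C I (Suc (Suc n)) =
     {Comp C g f | f g. f \<in> I \<and> g \<in> ideal_pow C I (Suc n) \<and> Cod C f = Dom C g}"

fun proj_pow :: "('o, 'm, 'x) tri_category_scheme \<Rightarrow> 'o set \<Rightarrow> nat \<Rightarrow> 'o set" where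
  "proj_pow C P 0 = {X. zero_object C X}"
| "proj_pow C P (Suc 0) = P"
| "proj_pow C P (Suc (Suc n)) =
     {X \<in> Ob C. \<exists>M A Q f g h. is_retract C X M \<and> dist_triangle C A M Q f g h \<and>
        A \<in> P \<and> Q \<in> proj_pow C P (Suc n)}"

text \<open>The infimum of the empty set is \<open>\<infinity>\<close>, the length of an object lying in no \<open>P\<^sub>n\<close>.\<close>

definition len :: "('o, 'm, 'x) tri_category_scheme \<Rightarrow> 'o set \<Rightarrow> 'o \<Rightarrow> enat" where
  "len C P X = (INF n \<in> {n. X \<in> proj_pow C P n}. enat n)"

end

theory Submission imports Defs begin

text \<open>Write \<open>P\<^sub>n\<close> and \<open>I\<^sup>n\<close> for the powers of the projective class. They determine each other: an
  object lies in \<open>P\<^sub>n\<close> iff \<open>I\<^sup>n\<close> kills it, and a map lies in \<open>I\<^sup>n\<close> iff it kills every map from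
  \<open>P\<^sub>n\<close> (\<open>ideal_pow_kills\<close>, \<open>ideal_powI\<close>, \<open>proj_powI\<close>). With \<open>j = max k m\<close> and \<open>N = j + (l - m)\<close>,
  which is the asserted bound, it therefore suffices that every \<open>f\<close> in \<open>I\<^sup>N\<close> with domain \<open>Y\<close>
  vanishes (\<open>middle_proj_pow\<close>).

  Factor \<open>f\<close> as \<open>f2 \<cdot> f1\<close> with \<open>f1\<close> in \<open>I\<^sup>j\<close> and \<open>f2\<close> in \<open>I\<^bsup>l - m\<^esup>\<close>. Since \<open>k \<le> j\<close> and \<open>X\<close> is in
  \<open>P\<^sub>k\<close>, the composite \<open>f1 \<cdot> \<alpha>\<close> is zero, so \<open>f1 = g \<cdot> \<beta>\<close> for some \<open>g\<close> defined on \<open>Z\<close>. The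
  hypothesis on \<open>\<gamma>\<close> puts \<open>g\<close> into \<open>I\<^sup>m\<close>: a map from an object of \<open>P\<^sub>m\<close> to \<open>Z\<close> is killed by
  \<open>\<gamma>\<close>, hence lifts along \<open>\<beta>\<close> to \<open>Y\<close>, and \<open>f1\<close> kills the lift because \<open>m \<le> j\<close>. So \<open>f2 \<cdot> g\<close>
  lies in \<open>I\<^sup>l\<close> and has domain \<open>Z\<close> in \<open>P\<^sub>l\<close>; it vanishes, and with it \<open>f = f2 \<cdot> g \<cdot> \<beta>\<close>.

  That the powers determine each other rests on a triangle \<open>A \<rightarrow> X \<rightarrow> X'\<close> over every object \<open>X\<close> with
  \<open>A\<close> in \<open>P\<^sub>n\<close> and \<open>X \<rightarrow> X'\<close> in \<open>I\<^sup>n\<close> (\<open>enough_proj_pow\<close>), which is obtained by iterating the case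
  \<open>n = 1\<close> with the octahedral axiom (\<open>fibre_of_composite\<close>).\<close>

section \<open>Maps in a category\<close>

context category
begin

lemma HomD: "f \<in> Hom C A B \<Longrightarrow> A \<in> Ob C \<and> B \<in> Ob C \<and> f \<in> Ar C \<and> Dom C f = A \<and> Cod C f = B"
  using dom_cod by (auto simp: Hom_def)

lemma Ar_Hom: "f \<in> Ar C \<Longrightarrow> f \<in> Hom C (Dom C f) (Cod C f)"
  by (simp add: Hom_def)

lemma comp_Dom_Cod:
  "\<lbrakk>f \<in> Ar C; g \<in> Ar C; Cod C f = Dom C g\<rbrakk> \<Longrightarrow> g \<cdot> f \<in> Hom C (Dom C f) (Cod C g)"
  using comp_hom Ar_Hom by metis

lemma is_retract_refl: "X \<in> Ob C \<Longrightarrow> is_retract C X X"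
  unfolding is_retract_def using ident_hom comp_ident by blast

lemma is_retract_trans:
  assumes "is_retract C X M" and "is_retract C M L"
  shows "is_retract C X L"
proof -
  obtain s r where sr: "s \<in> Hom C X M" "r \<in> Hom C M X" "r \<cdot> s = Ident C X"
    using assms(1) by (auto simp: is_retract_def)
  obtain t u where tu: "t \<in> Hom C M L" "u \<in> Hom C L M" "u \<cdot> t = Ident C M"
    using assms(2) by (auto simp: is_retract_def)
  have "(r \<cdot> u) \<cdot> (t \<cdot> s) = r \<cdot> ((u \<cdot> t) \<cdot> s)"
    using comp_assoc[OF comp_hom[OF sr(1) tu(1)] tu(2) sr(2)] comp_assoc[OF sr(1) tu(1,2)] by simp
  also have "\<dots> = Ident C X"
    using ident_comp[OF sr(1)] sr(3) tu(3) by simp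
  finally show ?thesis
    unfolding is_retract_def using sr tu comp_hom by blast
qed

lemma is_retract_Ob: "is_retract C X M \<Longrightarrow> X \<in> Ob C \<and> M \<in> Ob C"
  using HomD by (auto simp: is_retract_def)

end


section \<open>Zero and negative maps\<close>

context additive_category
begin

lemma zero_hom: "\<lbrakk>A \<in> Ob C; B \<in> Ob C\<rbrakk> \<Longrightarrow> Zero C A B \<in> Hom C A B"
  using comm_group.axioms(2)[OF hom_comm_group, THEN group.is_monoid, THEN monoid.one_closed]
  by (simp add: HomGrp_def)

lemma zero_add: "f \<in> Hom C A B \<Longrightarrow> Zero C A B \<boxplus> f = f"
  using comm_group.axioms(2)[OF hom_comm_group, THEN group.is_monoid, THEN monoid.l_one, of A B f]
    HomD[of f A B]
  by (simp add: HomGrp_def)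

lemma add_idem_zero:
  assumes "f \<in> Hom C A B" and "f \<boxplus> f = f"
  shows "f = Zero C A B"
proof -
  interpret G: comm_group "HomGrp C A B"
    using hom_comm_group HomD[OF assms(1)] by blast
  show ?thesis
    using G.l_cancel_one[of f f] assms by (simp add: HomGrp_def)
qed

lemma comp_zero:
  assumes "g \<in> Hom C B D" and "A \<in> Ob C"
  shows "g \<cdot> Zero C A B = Zero C A D"
proof (rule add_idem_zero)
  have z: "Zero C A B \<in> Hom C A B"
    using assms HomD zero_hom by blast
  show "g \<cdot> Zero C A B \<in> Hom C A D"
    using assms z comp_hom by blast
  show "g \<cdot> Zero C A B \<boxplus> g \<cdot> Zero C A B = g \<cdot> Zero C A B"
    using comp_add[OF z z assms(1)] zero_add[OF z] by simp
qed

lemma zero_comp: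
  assumes "f \<in> Hom C A B" and "D \<in> Ob C"
  shows "Zero C B D \<cdot> f = Zero C A D"
proof (rule add_idem_zero)
  have z: "Zero C B D \<in> Hom C B D"
    using assms HomD zero_hom by blast
  show "Zero C B D \<cdot> f \<in> Hom C A D"
    using assms z comp_hom by blast
  show "Zero C B D \<cdot> f \<boxplus> Zero C B D \<cdot> f = Zero C B D \<cdot> f"
    using add_comp[OF assms(1) z z] zero_add[OF z] by simp
qed

lemma neg_hom: "f \<in> Hom C A B \<Longrightarrow> Neg C f \<in> Hom C A B"
  using comm_group.axioms(2)[OF hom_comm_group, THEN group.inv_closed, of A B f] HomD[of f A B]
  by (simp add: Neg_def HomGrp_def)

lemma neg_add: "f \<in> Hom C A B \<Longrightarrow> Neg C f \<boxplus> f = Zero C A B"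
  using comm_group.axioms(2)[OF hom_comm_group, THEN group.l_inv, of A B f] HomD[of f A B]
  by (simp add: Neg_def HomGrp_def)

lemma neg_unique:
  assumes "f \<in> Hom C A B" and "g \<in> Hom C A B" and "g \<boxplus> f = Zero C A B"
  shows "Neg C f = g"
proof -
  interpret G: comm_group "HomGrp C A B"
    using hom_comm_group HomD[OF assms(1)] by blast
  show ?thesis
    using G.inv_equality[of g f] assms HomD[OF assms(1)] by (simp add: HomGrp_def Neg_def)
qed

lemma neg_neg:
  assumes f: "f \<in> Hom C A B"
  shows "Neg C (Neg C f) = f"
proof -
  interpret G: comm_group "HomGrp C A B"
    using hom_comm_group HomD[OF f] by blast
  show ?thesis
    using G.inv_inv[of f] HomD[OF f] HomD[OF neg_hom[OF f]] f by (simp add: HomGrp_def Neg_def)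
qed

lemma comp_neg:
  assumes f: "f \<in> Hom C A B" and g: "g \<in> Hom C B D"
  shows "g \<cdot> Neg C f = Neg C (g \<cdot> f)"
  using neg_unique[of "g \<cdot> f" A D "g \<cdot> Neg C f"] comp_hom[OF f g] comp_hom[OF neg_hom[OF f] g]
    comp_add[OF neg_hom[OF f] f g] neg_add[OF f] comp_zero[OF g] HomD[OF f] by simp

lemma neg_comp:
  assumes f: "f \<in> Hom C A B" and g: "g \<in> Hom C B D"
  shows "Neg C g \<cdot> f = Neg C (g \<cdot> f)"
  using neg_unique[of "g \<cdot> f" A D "Neg C g \<cdot> f"] comp_hom[OF f g] comp_hom[OF f neg_hom[OF g]]
    add_comp[OF f neg_hom[OF g] g] neg_add[OF g] zero_comp[OF f] HomD[OF g] by simp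

lemma zero_object_to: "\<lbrakk>zero_object C N; f \<in> Hom C A N; g \<in> Hom C A N\<rbrakk> \<Longrightarrow> f = g"
  unfolding zero_object_def using HomD by metis

lemma zero_object_from: "\<lbrakk>zero_object C N; f \<in> Hom C N A; g \<in> Hom C N A\<rbrakk> \<Longrightarrow> f = g"
  unfolding zero_object_def using HomD by metis

lemma zero_object_Ob: "zero_object C N \<Longrightarrow> N \<in> Ob C"
  by (simp add: zero_object_def)

lemma zero_object_iff: "zero_object C N \<longleftrightarrow> N \<in> Ob C \<and> Ident C N = Zero C N N"
proof
  assume N: "zero_object C N"
  then show "N \<in> Ob C \<and> Ident C N = Zero C N N"
    using zero_object_to[OF N] ident_hom zero_hom zero_object_Ob[OF N] by blast
next
  assume N: "N \<in> Ob C \<and> Ident C N = Zero C N N"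
  have "f = Zero C A N" if "f \<in> Hom C A N" for f A
    using ident_comp[OF that] zero_comp[OF that] N by simp
  moreover have "f = Zero C N A" if "f \<in> Hom C N A" for f A
    using comp_ident[OF that] comp_zero[OF that] N by simp
  ultimately show "zero_object C N"
    unfolding zero_object_def using N zero_hom by metis
qed

lemma retract_zero_object:
  assumes "is_retract C X N" and "zero_object C N"
  shows "zero_object C X"
proof -
  obtain s r where sr: "s \<in> Hom C X N" "r \<in> Hom C N X" "r \<cdot> s = Ident C X"
    using assms(1) by (auto simp: is_retract_def)
  have X: "X \<in> Ob C" and N: "N \<in> Ob C"
    using HomD[OF sr(1)] by auto
  have "s = Zero C X N"
    using zero_object_to[OF assms(2) sr(1)] zero_hom X N by blast
  then show ?thesis
    using sr comp_zero[OF sr(2) X] X by (simp add: zero_object_iff)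
qed

end


section \<open>Triangles\<close>

context triangulated_category
begin

lemma susp_hom: "f \<in> Hom C A B \<Longrightarrow> SuspMap C f \<in> Hom C (Susp C A) (Susp C B)"
  using susp_fully_faithful[of A B] HomD[of f A B] by (auto simp: bij_betw_def)

lemma susp_faithful:
  "\<lbrakk>f \<in> Hom C A B; g \<in> Hom C A B; SuspMap C f = SuspMap C g\<rbrakk> \<Longrightarrow> f = g"
  using susp_fully_faithful[of A B] HomD[of f A B] by (auto simp: bij_betw_def inj_on_def)

lemma susp_full:
  "\<lbrakk>A \<in> Ob C; B \<in> Ob C; u \<in> Hom C (Susp C A) (Susp C B)\<rbrakk> \<Longrightarrow> \<exists>v \<in> Hom C A B. u = SuspMap C v"
  using susp_fully_faithful[of A B] by (auto simp: bij_betw_def)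

lemma susp_full_neg:
  assumes "A \<in> Ob C" "B \<in> Ob C" "u \<in> Hom C (Susp C A) (Susp C B)"
  shows "\<exists>v \<in> Hom C A B. u = Neg C (SuspMap C v)"
  using susp_full[OF assms(1,2) neg_hom[OF assms(3)]] neg_neg[OF assms(3)] by metis

lemma susp_zero_object:
  assumes "zero_object C N"
  shows "zero_object C (Susp C N)"
proof -
  have N: "N \<in> Ob C" "Ident C N = Zero C N N"
    using assms by (auto simp: zero_object_iff)
  have z: "Zero C N N \<in> Hom C N N"
    using N zero_hom by blast
  have "SuspMap C (Zero C N N) = Zero C (Susp C N) (Susp C N)"
    using add_idem_zero[OF susp_hom[OF z]] susp_add[OF z z] zero_add[OF z] by simp
  then show ?thesis
    using N susp_ident[of N] susp_ob by (simp add: zero_object_iff)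
qed

lemma dist_triangleD:
  assumes "dist_triangle C X Y Z f g h"
  shows "f \<in> Hom C X Y" "g \<in> Hom C Y Z" "h \<in> Hom C Z (Susp C X)"
    "X \<in> Ob C" "Y \<in> Ob C" "Z \<in> Ob C"
  using assms HomD by (auto simp: dist_triangle_def candidate_def)

lemma rotate:
  "dist_triangle C X Y Z f g h \<Longrightarrow> dist_triangle C Y Z (Susp C X) g h (Neg C (SuspMap C f))"
  using TR2[of X Y Z f g h] by (simp add: dist_triangle_def)

lemma unrotate:
  assumes "dist_triangle C Y Z (Susp C X) g h (Neg C (SuspMap C f))" and "f \<in> Hom C X Y"
  shows "dist_triangle C X Y Z f g h"
  using TR2[of X Y Z f g h] dist_triangleD[OF assms(1)] assms by (simp add: candidate_def)

lemma zero_ident_triangle: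
  assumes N: "zero_object C N" and V: "V \<in> Ob C"
  shows "\<exists>h. dist_triangle C N V V (Zero C N V) (Ident C V) h"
proof -
  have SN: "zero_object C (Susp C N)"
    by (rule susp_zero_object[OF N])
  have z: "Zero C N V \<in> Hom C N V"
    using zero_hom zero_object_Ob[OF N] V by blast
  have "Neg C (SuspMap C (Zero C N V)) = Zero C (Susp C N) (Susp C V)"
    using zero_object_from[OF SN neg_hom[OF susp_hom[OF z]]] zero_hom zero_object_Ob[OF SN]
      susp_ob[OF V] by blast
  then have "dist_triangle C V V (Susp C N) (Ident C V) (Zero C V (Susp C N))
      (Neg C (SuspMap C (Zero C N V)))"
    using TR1_ident[OF V SN] by simp
  then show ?thesis
    using unrotate z by blast
qed

text \<open>The second map of a triangle is a weak cokernel of the first: a map \<open>b\<close>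
  killing \<open>f\<close> is part of a commutative square from \<open>f\<close> to \<open>0 \<rightarrow> V\<close>, and the cone of the latter
  is \<open>V\<close>.\<close>

lemma triangle_extend:
  assumes t: "dist_triangle C X Y Z f g h"
    and b: "b \<in> Hom C Y V" and bf: "b \<cdot> f = Zero C X V"
  shows "\<exists>c \<in> Hom C Z V. b = c \<cdot> g"
proof -
  note T = dist_triangleD[OF t]
  obtain N where N: "zero_object C N"
    using ex_zero_object by blast
  have V: "V \<in> Ob C" and NOb: "N \<in> Ob C"
    using HomD[OF b] zero_object_Ob[OF N] by auto
  obtain h' where t': "dist_triangle C N V V (Zero C N V) (Ident C V) h'"
    using zero_ident_triangle[OF N V] by blast
  have a: "Zero C X N \<in> Hom C X N"
    using zero_hom T NOb by blast
  have "b \<cdot> f = Zero C N V \<cdot> Zero C X N"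
    using bf zero_comp[OF a V] by simp
  from TR3[OF t t' a b this] show ?thesis
    using ident_comp[OF b] by metis
qed

text \<open>Dually, the first map is a weak kernel of the second. Comparing the rotation of the triangle
  on the identity of \<open>A\<close> with the rotation of the given one yields the lift after suspension, with
  the same sign on both sides.\<close>

lemma triangle_lift:
  assumes t: "dist_triangle C X Y Z f g h"
    and b: "b \<in> Hom C A Y" and gb: "g \<cdot> b = Zero C A Z"
  shows "\<exists>c \<in> Hom C A X. b = f \<cdot> c"
proof -
  note T = dist_triangleD[OF t]
  obtain N where N: "zero_object C N"
    using ex_zero_object by blast
  have A: "A \<in> Ob C" and NOb: "N \<in> Ob C"
    using HomD[OF b] zero_object_Ob[OF N] by auto
  have t1: "dist_triangle C A N (Susp C A) (Zero C A N) (Zero C N (Susp C A))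
      (Neg C (SuspMap C (Ident C A)))"
    using rotate[OF TR1_ident[OF A N]] .
  have z: "Zero C N Z \<in> Hom C N Z" and z': "Zero C A N \<in> Hom C A N"
    using zero_hom T NOb A by auto
  have "Zero C N Z \<cdot> Zero C A N = g \<cdot> b"
    using gb zero_comp[OF z'] T by simp
  from TR3[OF t1 rotate[OF t] b z this]
  obtain c where c: "c \<in> Hom C (Susp C A) (Susp C X)"
    and eq: "SuspMap C b \<cdot> Neg C (SuspMap C (Ident C A)) = Neg C (SuspMap C f) \<cdot> c"
    by blast
  obtain v where v: "v \<in> Hom C A X" "c = SuspMap C v"
    using susp_full[OF A _ c] T by blast
  have i: "Ident C A \<in> Hom C A A"
    using ident_hom A by blast
  have "Neg C (SuspMap C b) = Neg C (SuspMap C (f \<cdot> v))"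
    using eq comp_neg[OF susp_hom[OF i] susp_hom[OF b]] neg_comp[OF c susp_hom[OF T(1)]]
      susp_comp[OF i b] comp_ident[OF b] susp_comp[OF v(1) T(1)] v(2) by simp
  then have "SuspMap C b = SuspMap C (f \<cdot> v)"
    using neg_neg susp_hom b comp_hom[OF v(1) T(1)] by metis
  then show ?thesis
    using susp_faithful[OF b comp_hom[OF v(1) T(1)]] v(1) by blast
qed

text \<open>Every map into a suspension is the connecting map of a triangle. Its cone is isomorphic to a
  suspension, and since the suspension is full, the maps of the resulting triangle are negatives
  of suspensions, so that it can be rotated back twice.\<close>

lemma connecting_map:
  assumes h: "h \<in> Hom C B (Susp C A)" and A: "A \<in> Ob C"
  shows "\<exists>E i j. dist_triangle C A E B i j h"
proof -
  obtain V q c where t: "dist_triangle C B (Susp C A) V h q c"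
    using TR1_cone[OF h] by blast
  note T = dist_triangleD[OF t]
  obtain E u where E: "E \<in> Ob C" and u: "is_iso C (Susp C E) V u"
    using susp_ess_surj[OF T(6)] by blast
  obtain w where uH: "u \<in> Hom C (Susp C E) V" and w: "w \<in> Hom C V (Susp C E)"
    and wu: "w \<cdot> u = Ident C (Susp C E)" and uw: "u \<cdot> w = Ident C V"
    using u by (auto simp: is_iso_def)
  have isoI: "is_iso C D D (Ident C D)" if "D \<in> Ob C" for D
    using ident_hom[OF that] comp_ident unfolding is_iso_def by blast
  have wq: "w \<cdot> q \<in> Hom C (Susp C A) (Susp C E)" and cu: "c \<cdot> u \<in> Hom C (Susp C E) (Susp C B)"
    using comp_hom[OF T(2) w] comp_hom[OF uH T(3)] by auto
  have t1: "dist_triangle C B (Susp C A) (Susp C E) h (w \<cdot> q) (c \<cdot> u)"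
  proof (rule TR1_iso[OF t _ isoI[OF T(4)] isoI[OF T(5)]])
    show "candidate C B (Susp C A) (Susp C E) h (w \<cdot> q) (c \<cdot> u)"
      using T(1) wq cu by (simp add: candidate_def)
    show "is_iso C V (Susp C E) w"
      using uH w wu uw by (auto simp: is_iso_def)
    show "Ident C (Susp C A) \<cdot> h = h \<cdot> Ident C B"
      using ident_comp[OF T(1)] comp_ident[OF T(1)] by simp
    show "w \<cdot> q = w \<cdot> q \<cdot> Ident C (Susp C A)"
      using comp_ident[OF wq] by simp
    show "SuspMap C (Ident C B) \<cdot> c = c \<cdot> u \<cdot> w"
      using susp_ident[OF T(4)] ident_comp[OF T(3)] comp_assoc[OF w uH T(3)] uw comp_ident[OF T(3)]
      by simp
  qed
  obtain i where i: "i \<in> Hom C A E" "w \<cdot> q = Neg C (SuspMap C i)"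
    using susp_full_neg[OF A E wq] by blast
  obtain j where j: "j \<in> Hom C E B" "c \<cdot> u = Neg C (SuspMap C j)"
    using susp_full_neg[OF E T(4) cu] by blast
  have "dist_triangle C E B (Susp C A) j h (Neg C (SuspMap C i))"
    using unrotate[OF _ j(1)] t1 i(2) j(2) by simp
  then show ?thesis
    using unrotate[OF _ i(1)] by blast
qed

text \<open>The octahedral axiom for composites read through fibres instead of cones: the fibre of
  \<open>p \<cdot> f\<close> is an extension of the fibre of \<open>p\<close> by the fibre of \<open>f\<close>. The fibre \<open>E\<close> is built from
  its extension class \<open>B \<rightarrow> X' \<rightarrow> \<Sigma>A\<close>, and the axiom is applied to that composite.\<close>

lemma fibre_of_composite:
  assumes t1: "dist_triangle C A X X' a f d"
    and t2: "dist_triangle C B X' X'' b p e"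
  shows "\<exists>E i j h w h'. dist_triangle C A E B i j h \<and> dist_triangle C E X X'' w (p \<cdot> f) h'"
proof -
  note T1 = dist_triangleD[OF t1] and T2 = dist_triangleD[OF t2]
  obtain E i j where tE: "dist_triangle C A E B i j (d \<cdot> b)"
    using connecting_map[OF comp_hom[OF T2(1) T1(3)] T1(4)] by blast
  note TE = dist_triangleD[OF tE]
  obtain x y where xy: "dist_triangle C X'' (Susp C E) (Susp C X) x y
      (SuspMap C p \<cdot> Neg C (SuspMap C f))"
    using TR4[OF t2 rotate[OF rotate[OF t1]] rotate[OF rotate[OF tE]]] by blast
  obtain w where w: "w \<in> Hom C E X" "y = Neg C (SuspMap C w)"
    using susp_full_neg[OF TE(5) T1(5) dist_triangleD(2)[OF xy]] by blast
  have "SuspMap C p \<cdot> Neg C (SuspMap C f) = Neg C (SuspMap C (p \<cdot> f))"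
    using comp_neg[OF susp_hom[OF T1(2)] susp_hom[OF T2(2)]] susp_comp[OF T1(2) T2(2)] by simp
  then have "dist_triangle C X X'' (Susp C E) (p \<cdot> f) x (Neg C (SuspMap C w))"
    using unrotate[OF _ comp_hom[OF T1(2) T2(2)]] xy w(2) by simp
  then have "dist_triangle C E X X'' w (p \<cdot> f) x"
    using unrotate[OF _ w(1)] by blast
  then show ?thesis
    using tE by blast
qed

end


section \<open>Powers of a projective class\<close>

context projective_class
begin

lemma null_Ar: "f \<in> I \<Longrightarrow> f \<in> Ar C"
  using null_maps by blast

lemma proj_Ob: "A \<in> P \<Longrightarrow> A \<in> Ob C"
  using projectives by blast

lemma null_kills: "\<lbrakk>f \<in> I; f \<in> Hom C X Y; A \<in> P; p \<in> Hom C A X\<rbrakk> \<Longrightarrow> f \<cdot> p = Zero C A Y"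
  using projectives by blast

lemma nullI:
  "\<lbrakk>f \<in> Hom C X Y; \<And>A p. \<lbrakk>A \<in> P; p \<in> Hom C A X\<rbrakk> \<Longrightarrow> f \<cdot> p = Zero C A Y\<rbrakk> \<Longrightarrow> f \<in> I"
  by (subst null_maps) (auto dest: HomD)

lemma projI:
  "\<lbrakk>A \<in> Ob C; \<And>X Y f p. \<lbrakk>f \<in> I; f \<in> Hom C X Y; p \<in> Hom C A X\<rbrakk> \<Longrightarrow> f \<cdot> p = Zero C A Y\<rbrakk> \<Longrightarrow> A \<in> P"
  by (subst projectives) auto

lemma null_precomp:
  assumes f: "f \<in> Hom C X Y" and g: "g \<in> I" "g \<in> Hom C Y Z"
  shows "g \<cdot> f \<in> I"
proof (rule nullI[OF comp_hom[OF f g(2)]])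
  fix A p assume p: "A \<in> P" "p \<in> Hom C A X"
  show "g \<cdot> f \<cdot> p = Zero C A Z"
    using comp_assoc[OF p(2) f g(2)] null_kills[OF g p(1) comp_hom[OF p(2) f]] by simp
qed

lemma null_postcomp:
  assumes f: "f \<in> I" "f \<in> Hom C X Y" and g: "g \<in> Hom C Y Z"
  shows "g \<cdot> f \<in> I"
proof (rule nullI[OF comp_hom[OF f(2) g]])
  fix A p assume p: "A \<in> P" "p \<in> Hom C A X"
  show "g \<cdot> f \<cdot> p = Zero C A Z"
    using comp_assoc[OF p(2) f(2) g] null_kills[OF f p] comp_zero[OF g] proj_Ob[OF p(1)] by simp
qed

text \<open>Because \<open>I\<close> is an ideal, composing it with all maps gives back \<open>I\<close>; so the recursion for its
  powers starts at \<open>0\<close>, and inductions on the exponent need no separate case for \<open>1\<close>.\<close>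

lemma ideal_pow_Suc:
  "ideal_pow C I (Suc n) = {g \<cdot> f | f g. f \<in> I \<and> g \<in> ideal_pow C I n \<and> Cod C f = Dom C g}"
proof (cases n)
  case 0
  have "\<exists>f g. h = g \<cdot> f \<and> f \<in> I \<and> g \<in> Ar C \<and> Cod C f = Dom C g" if "h \<in> I" for h
    using that ident_comp[OF Ar_Hom[OF null_Ar[OF that]]] ident_hom dom_cod null_Ar[OF that] HomD
    by metis
  moreover have "g \<cdot> f \<in> I" if "f \<in> I" "g \<in> Ar C" "Cod C f = Dom C g" for f g
    using null_postcomp Ar_Hom null_Ar that by metis
  ultimately show ?thesis
    using 0 by auto
qed simp

lemma ideal_pow_SucE:
  assumes "h \<in> ideal_pow C I (Suc n)" and "h \<in> Hom C X Z"
    and "ideal_pow C I n \<subseteq> Ar C"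
  obtains Y f g where "f \<in> I" "f \<in> Hom C X Y" "g \<in> ideal_pow C I n" "g \<in> Hom C Y Z" "h = g \<cdot> f"
proof -
  obtain f g where fg: "h = g \<cdot> f" "f \<in> I" "g \<in> ideal_pow C I n" "Cod C f = Dom C g"
    using assms(1) by (auto simp: ideal_pow_Suc)
  have "h \<in> Hom C (Dom C f) (Cod C g)"
    using comp_Dom_Cod null_Ar fg assms(3) by blast
  then have "Dom C f = X" "Cod C g = Z"
    using assms(2) HomD by metis+
  then show ?thesis
    using that[of f "Cod C f" g] fg Ar_Hom null_Ar assms(3) by (metis subsetD)
qed

lemma ideal_pow_SucI:
  assumes "f \<in> I" "f \<in> Hom C X Y" "g \<in> ideal_pow C I n" "g \<in> Hom C Y Z"
  shows "g \<cdot> f \<in> ideal_pow C I (Suc n)"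
proof -
  have "Cod C f = Dom C g"
    using HomD[OF assms(2)] HomD[OF assms(4)] by simp
  then show ?thesis
    unfolding ideal_pow_Suc using assms by blast
qed

lemma ideal_pow_Ar: "ideal_pow C I n \<subseteq> Ar C"
proof (induction n)
  case (Suc n)
  have "g \<cdot> f \<in> Ar C" if "f \<in> I" "g \<in> ideal_pow C I n" "Cod C f = Dom C g" for f g
    using HomD[OF comp_Dom_Cod[OF null_Ar[OF that(1)] _ that(3)]] Suc that(2) by blast
  then show ?case
    unfolding ideal_pow_Suc by blast
qed simp

lemma ideal_pow_precomp:
  assumes "f \<in> Hom C X Y" and "g \<in> ideal_pow C I n" and "g \<in> Hom C Y Z"
  shows "g \<cdot> f \<in> ideal_pow C I n"
proof (cases n)
  case 0
  then show ?thesis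
    using comp_hom[OF assms(1,3)] HomD by simp
next
  case (Suc j)
  obtain V u v where uv: "u \<in> I" "u \<in> Hom C Y V" "v \<in> ideal_pow C I j" "v \<in> Hom C V Z" "g = v \<cdot> u"
    using ideal_pow_SucE[OF _ assms(3) ideal_pow_Ar] assms(2) Suc by metis
  have "g \<cdot> f = v \<cdot> (u \<cdot> f)"
    using comp_assoc[OF assms(1) uv(2,4)] uv(5) by simp
  then show ?thesis
    using ideal_pow_SucI[OF null_precomp[OF assms(1) uv(1,2)] comp_hom[OF assms(1) uv(2)] uv(3,4)] Suc
    by simp
qed

lemma ideal_pow_postcomp:
  "\<lbrakk>f \<in> ideal_pow C I n; f \<in> Hom C X Y; g \<in> Hom C Y Z\<rbrakk> \<Longrightarrow> g \<cdot> f \<in> ideal_pow C I n"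
proof (induction n arbitrary: f X)
  case 0
  then show ?case
    using comp_hom HomD by fastforce
next
  case (Suc n)
  obtain V u v where uv: "u \<in> I" "u \<in> Hom C X V" "v \<in> ideal_pow C I n" "v \<in> Hom C V Y" "f = v \<cdot> u"
    using ideal_pow_SucE[OF Suc.prems(1,2) ideal_pow_Ar] by metis
  have "g \<cdot> f = (g \<cdot> v) \<cdot> u"
    using comp_assoc[OF uv(2,4) Suc.prems(3)] uv(5) by simp
  then show ?case
    using ideal_pow_SucI[OF uv(1,2) Suc.IH[OF uv(3,4) Suc.prems(3)] comp_hom[OF uv(4) Suc.prems(3)]]
    by simp
qed

lemma ideal_pow_addE:
  assumes "h \<in> ideal_pow C I (a + b)" and "h \<in> Hom C X Z"
  obtains Y f g where "f \<in> ideal_pow C I a" "f \<in> Hom C X Y" "g \<in> ideal_pow C I b" "g \<in> Hom C Y Z"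
    "h = g \<cdot> f"
proof -
  have "\<exists>Y f g. f \<in> ideal_pow C I a \<and> f \<in> Hom C X Y \<and> g \<in> ideal_pow C I b \<and> g \<in> Hom C Y Z \<and> h = g \<cdot> f"
    using assms
  proof (induction a arbitrary: h X)
    case 0
    then show ?case
      using ident_hom comp_ident HomD by fastforce
  next
    case (Suc a)
    obtain V u v where uv: "u \<in> I" "u \<in> Hom C X V" "v \<in> ideal_pow C I (a + b)" "v \<in> Hom C V Z" "h = v \<cdot> u"
      using ideal_pow_SucE[OF _ Suc.prems(2) ideal_pow_Ar] Suc.prems(1) by (metis add_Suc)
    obtain Y f g where fg: "f \<in> ideal_pow C I a" "f \<in> Hom C V Y" "g \<in> ideal_pow C I b" "g \<in> Hom C Y Z"
      "v = g \<cdot> f"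
      using Suc.IH[OF uv(3,4)] by blast
    have "h = g \<cdot> (f \<cdot> u)"
      using comp_assoc[OF uv(2) fg(2,4)] uv(5) fg(5) by simp
    then show ?case
      using ideal_pow_SucI[OF uv(1,2) fg(1,2)] comp_hom[OF uv(2) fg(2)] fg by blast
  qed
  then show ?thesis
    using that by blast
qed

lemma ideal_pow_addI:
  "\<lbrakk>f \<in> ideal_pow C I a; f \<in> Hom C X Y; g \<in> ideal_pow C I b; g \<in> Hom C Y Z\<rbrakk>
    \<Longrightarrow> g \<cdot> f \<in> ideal_pow C I (a + b)"
proof (induction a arbitrary: f X)
  case 0
  then show ?case
    using ideal_pow_precomp by simp
next
  case (Suc a)
  obtain V u v where uv: "u \<in> I" "u \<in> Hom C X V" "v \<in> ideal_pow C I a" "v \<in> Hom C V Y" "f = v \<cdot> u"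
    using ideal_pow_SucE[OF Suc.prems(1,2) ideal_pow_Ar] by metis
  have "g \<cdot> f = (g \<cdot> v) \<cdot> u"
    using comp_assoc[OF uv(2,4) Suc.prems(4)] uv(5) by simp
  then show ?case
    using ideal_pow_SucI[OF uv(1,2) Suc.IH[OF uv(3,4) Suc.prems(3,4)] comp_hom[OF uv(4) Suc.prems(4)]]
    by simp
qed

lemma ideal_pow_antimono:
  assumes "a \<le> b"
  shows "ideal_pow C I b \<subseteq> ideal_pow C I a"
proof
  fix h assume h: "h \<in> ideal_pow C I b"
  then have H: "h \<in> Hom C (Dom C h) (Cod C h)"
    using ideal_pow_Ar Ar_Hom by blast
  have "h \<in> ideal_pow C I (a + (b - a))"
    using h assms by simp
  then show "h \<in> ideal_pow C I a"
    using ideal_pow_addE[OF _ H] ideal_pow_postcomp by metis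
qed

lemma proj_retract:
  assumes "is_retract C X A" and "A \<in> P"
  shows "X \<in> P"
proof -
  obtain s r where sr: "s \<in> Hom C X A" "r \<in> Hom C A X" "r \<cdot> s = Ident C X"
    using assms(1) by (auto simp: is_retract_def)
  show ?thesis
  proof (rule projI)
    show "X \<in> Ob C" using HomD sr by blast
    fix V W f p assume f: "f \<in> I" "f \<in> Hom C V W" and p: "p \<in> Hom C X V"
    have "f \<cdot> p = (f \<cdot> (p \<cdot> r)) \<cdot> s"
      using comp_assoc[OF sr(1) sr(2) p] comp_assoc[OF sr(1) comp_hom[OF sr(2) p] f(2)]
        sr(3) comp_ident[OF p] by simp
    also have "f \<cdot> (p \<cdot> r) = Zero C A W"
      using null_kills[OF f assms(2) comp_hom[OF sr(2) p]] .
    finally show "f \<cdot> p = Zero C X W"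
      using zero_comp[OF sr(1)] HomD[OF f(2)] by simp
  qed
qed

lemma proj_pow_retract:
  assumes "is_retract C X M" and "M \<in> proj_pow C P n"
  shows "X \<in> proj_pow C P n"
proof -
  consider "n = 0" | "n = Suc 0" | j where "n = Suc (Suc j)"
    by (metis not0_implies_Suc)
  then show ?thesis
  proof cases
    case 1
    then show ?thesis using assms retract_zero_object by simp
  next
    case 2
    then show ?thesis using assms proj_retract by simp
  next
    case 3
    obtain M' A Q f g h where "is_retract C M M'" and t: "dist_triangle C A M' Q f g h"
      and A: "A \<in> P" and Q: "Q \<in> proj_pow C P (Suc j)"
      using assms(2) unfolding 3 by auto
    then have X: "X \<in> Ob C" and XM': "is_retract C X M'"
      using is_retract_trans[OF assms(1)] is_retract_Ob[OF assms(1)] by auto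
    show ?thesis
      unfolding 3 proj_pow.simps mem_Collect_eq
      by (intro conjI exI) (rule X XM' t A Q)+
  qed
qed

text \<open>The next two lemmas start the recursion for the classes \<open>P\<^sub>n\<close> at \<open>0\<close> as well: an extension of a
  zero object by a projective is projective, and every projective arises in this way.\<close>

lemma proj_pow_SucI:
  assumes t: "dist_triangle C A M Q f g h" and A: "A \<in> P" and Q: "Q \<in> proj_pow C P n"
  shows "M \<in> proj_pow C P (Suc n)"
proof (cases n)
  case 0
  note T = dist_triangleD[OF t]
  have "M \<in> P"
  proof (rule projI[OF T(5)])
    fix X Y u p assume u: "u \<in> I" "u \<in> Hom C X Y" and p: "p \<in> Hom C M X"
    have up: "u \<cdot> p \<in> Hom C M Y"
      using comp_hom p u by blast
    have Y: "Y \<in> Ob C"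
      using HomD u by blast
    have "u \<cdot> p \<cdot> f = Zero C A Y"
      using comp_assoc[OF T(1) p u(2)] null_kills[OF u A comp_hom[OF T(1) p]] by simp
    then obtain c where c: "c \<in> Hom C Q Y" "u \<cdot> p = c \<cdot> g"
      using triangle_extend[OF t up] by blast
    have "zero_object C Q"
      using Q 0 by simp
    then have "c = Zero C Q Y"
      by (rule zero_object_from[OF _ c(1) zero_hom[OF T(6) Y]])
    then show "u \<cdot> p = Zero C M Y"
      using c zero_comp[OF T(2) Y] by simp
  qed
  then show ?thesis using 0 by simp
next
  case (Suc j)
  have M: "M \<in> Ob C"
    by (rule dist_triangleD(5)[OF t])
  have Q': "Q \<in> proj_pow C P (Suc j)"
    using Q Suc by simp
  show ?thesis
    unfolding Suc proj_pow.simps mem_Collect_eq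
    by (intro conjI exI) (rule M is_retract_refl[OF M] t A Q')+
qed

lemma proj_pow_SucE:
  assumes "X \<in> proj_pow C P (Suc n)"
  obtains M A Q f g h where "is_retract C X M" "dist_triangle C A M Q f g h" "A \<in> P"
    "Q \<in> proj_pow C P n"
proof (cases n)
  case 0
  obtain N where N: "zero_object C N"
    using ex_zero_object by blast
  have X: "X \<in> P" "X \<in> Ob C"
    using assms 0 proj_Ob by auto
  show ?thesis
    using that[OF is_retract_refl TR1_ident[OF _ N]] X N 0 by simp
next
  case (Suc j)
  then obtain M A Q f g h where "is_retract C X M" "dist_triangle C A M Q f g h" "A \<in> P"
    "Q \<in> proj_pow C P (Suc j)"
    using assms by auto
  then show ?thesis
    by (rule that[unfolded Suc])
qed


section \<open>The powers form projective classes\<close>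

text \<open>A composite of \<open>n\<close> null maps kills an object built from \<open>n\<close> projectives, one projective at a
  time: the first map vanishes on the bottom projective, hence factors through the quotient.\<close>

lemma ideal_pow_kills:
  "\<lbrakk>f \<in> ideal_pow C I n; f \<in> Hom C X Y; X \<in> proj_pow C P n\<rbrakk> \<Longrightarrow> f = Zero C X Y"
proof (induction n arbitrary: f X)
  case 0
  have "zero_object C X" and X: "X \<in> Ob C" and Y: "Y \<in> Ob C"
    using 0(3) HomD[OF 0(2)] by auto
  then show ?case
    by (intro zero_object_from[OF _ 0(2) zero_hom[OF X Y]])
next
  case (Suc n)
  have Y: "Y \<in> Ob C"
    using HomD[OF Suc.prems(2)] by blast
  obtain V u v where uv: "u \<in> I" "u \<in> Hom C X V" "v \<in> ideal_pow C I n" "v \<in> Hom C V Y" "f = v \<cdot> u"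
    using ideal_pow_SucE[OF Suc.prems(1,2) ideal_pow_Ar] by metis
  obtain M A Q i j h where M: "is_retract C X M" and t: "dist_triangle C A M Q i j h"
    and A: "A \<in> P" and Q: "Q \<in> proj_pow C P n"
    using proj_pow_SucE[OF Suc.prems(3)] by metis
  note T = dist_triangleD[OF t]
  obtain s r where sr: "s \<in> Hom C X M" "r \<in> Hom C M X" "r \<cdot> s = Ident C X"
    using M by (auto simp: is_retract_def)
  have ur: "u \<cdot> r \<in> Hom C M V"
    using comp_hom sr uv by blast
  have "u \<cdot> r \<cdot> i = Zero C A V"
    using comp_assoc[OF T(1) sr(2) uv(2)] null_kills[OF uv(1,2) A comp_hom[OF T(1) sr(2)]] by simp
  then obtain c where c: "c \<in> Hom C Q V" "u \<cdot> r = c \<cdot> j"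
    using triangle_extend[OF t ur] by blast
  have "v \<cdot> c = Zero C Q Y"
    using Suc.IH[OF ideal_pow_precomp[OF c(1) uv(3,4)] comp_hom[OF c(1) uv(4)] Q] .
  then have "v \<cdot> (u \<cdot> r) = Zero C M Y"
    using c comp_assoc[OF T(2) c(1) uv(4)] zero_comp[OF T(2) Y] by simp
  moreover have "f = (v \<cdot> (u \<cdot> r)) \<cdot> s"
    using comp_assoc[OF sr(1) ur uv(4)] comp_assoc[OF sr(1,2) uv(2)] sr(3) comp_ident[OF uv(2)] uv(5)
    by simp
  ultimately show ?case
    using zero_comp[OF sr(1) Y] by simp
qed

text \<open>The \<open>n\<close>-th stage of an Adams tower over \<open>X\<close>: compose \<open>n\<close> null maps, each with projective fibre,
  and take the fibre of the composite.\<close>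

lemma enough_proj_pow:
  "X \<in> Ob C \<Longrightarrow> \<exists>A \<in> proj_pow C P n. \<exists>Y p f h. dist_triangle C A X Y p f h \<and> f \<in> ideal_pow C I n"
proof (induction n arbitrary: X)
  case 0
  obtain N where N: "zero_object C N"
    using ex_zero_object by blast
  obtain h where "dist_triangle C N X X (Zero C N X) (Ident C X) h"
    using zero_ident_triangle[OF N 0] by blast
  moreover have "Ident C X \<in> Ar C"
    using ident_hom[OF 0] HomD by blast
  ultimately show ?case
    using N by (simp, blast)
next
  case (Suc n)
  obtain A X' a f d where t1: "dist_triangle C A X X' a f d" and A: "A \<in> P" and f: "f \<in> I"
    using enough_projectives[OF Suc.prems] by blast
  note T1 = dist_triangleD[OF t1]
  obtain B X'' b p e where t2: "dist_triangle C B X' X'' b p e" and B: "B \<in> proj_pow C P n"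
    and p: "p \<in> ideal_pow C I n"
    using Suc.IH[OF T1(6)] by blast
  obtain E i j h w h' where tE: "dist_triangle C A E B i j h"
    and tX: "dist_triangle C E X X'' w (p \<cdot> f) h'"
    using fibre_of_composite[OF t1 t2] by blast
  show ?case
    using tX proj_pow_SucI[OF tE A B] ideal_pow_SucI[OF f T1(2) p dist_triangleD(2)[OF t2]] by blast
qed

text \<open>In a triangle \<open>A \<rightarrow> X \<rightarrow> X'\<close> as above, every map that kills \<open>A \<rightarrow> X\<close> factors through \<open>X \<rightarrow> X'\<close>,
  which lies in the ideal \<open>I\<^sup>n\<close>.\<close>

lemma ideal_powI:
  assumes g: "g \<in> Hom C X Y"
    and kills: "\<And>A p. \<lbrakk>A \<in> proj_pow C P n; p \<in> Hom C A X\<rbrakk> \<Longrightarrow> g \<cdot> p = Zero C A Y"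
  shows "g \<in> ideal_pow C I n"
proof -
  have "X \<in> Ob C"
    using HomD[OF g] by blast
  then obtain A X' p f h where t: "dist_triangle C A X X' p f h" and A: "A \<in> proj_pow C P n"
    and f: "f \<in> ideal_pow C I n"
    using enough_proj_pow by blast
  note T = dist_triangleD[OF t]
  show ?thesis
    using triangle_extend[OF t g kills[OF A T(1)]] ideal_pow_postcomp[OF f T(2)] by blast
qed

text \<open>Here the map \<open>X \<rightarrow> X'\<close> in \<open>I\<^sup>n\<close> must itself be zero, so the triangle \<open>A \<rightarrow> X \<rightarrow> X'\<close> splits and
  makes \<open>X\<close> a retract of the object \<open>A\<close> of \<open>P\<^sub>n\<close>.\<close>

lemma proj_powI:
  assumes X: "X \<in> Ob C"
    and killed: "\<And>Y f. \<lbrakk>f \<in> ideal_pow C I n; f \<in> Hom C X Y\<rbrakk> \<Longrightarrow> f = Zero C X Y"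
  shows "X \<in> proj_pow C P n"
proof -
  obtain A Y p f h where t: "dist_triangle C A X Y p f h" and A: "A \<in> proj_pow C P n"
    and f: "f \<in> ideal_pow C I n"
    using enough_proj_pow[OF X] by blast
  note T = dist_triangleD[OF t]
  have i: "Ident C X \<in> Hom C X X"
    using ident_hom X by blast
  have "f \<cdot> Ident C X = Zero C X Y"
    using killed[OF f T(2)] comp_ident[OF T(2)] by simp
  then obtain s where "s \<in> Hom C X A" "Ident C X = p \<cdot> s"
    using triangle_lift[OF t i] by blast
  then have "is_retract C X A"
    unfolding is_retract_def using T(1) by metis
  then show ?thesis
    using proj_pow_retract A by blast
qed


section \<open>The length of an extension\<close>

text \<open>Of the \<open>max k m\<close> null factors of a map on \<open>Y\<close> that are spent on making it vanish on \<open>X\<close>, as many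
  as \<open>m\<close> count again on \<open>Z\<close>, because \<open>\<gamma>\<close> lies in \<open>I\<^sup>m\<close>; so only \<open>l - m\<close> more are needed.\<close>

lemma middle_proj_pow:
  assumes t: "dist_triangle C X Y Z \<alpha> \<beta> \<gamma>"
    and X: "X \<in> proj_pow C P k" and Z: "Z \<in> proj_pow C P l"
    and \<gamma>: "\<gamma> \<in> ideal_pow C I m" and "m \<le> l"
  shows "Y \<in> proj_pow C P (max k m + (l - m))"
proof (rule proj_powI)
  note T = dist_triangleD[OF t]
  show "Y \<in> Ob C" by (rule T(5))
  fix W f assume f: "f \<in> ideal_pow C I (max k m + (l - m))" and fH: "f \<in> Hom C Y W"
  obtain V f1 f2 where f1: "f1 \<in> ideal_pow C I (max k m)" "f1 \<in> Hom C Y V"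
    and f2: "f2 \<in> ideal_pow C I (l - m)" "f2 \<in> Hom C V W" and f_eq: "f = f2 \<cdot> f1"
    by (rule ideal_pow_addE[OF f fH])
  have f1k: "f1 \<in> ideal_pow C I k" and f1m: "f1 \<in> ideal_pow C I m"
    by (rule subsetD[OF ideal_pow_antimono f1(1)], simp)+
  have "f1 \<cdot> \<alpha> = Zero C X V"
    using ideal_pow_kills[OF ideal_pow_precomp[OF T(1) f1k f1(2)] comp_hom[OF T(1) f1(2)] X] .
  then obtain g where g: "g \<in> Hom C Z V" and g_eq: "f1 = g \<cdot> \<beta>"
    using triangle_extend[OF t f1(2)] by blast
  have gm: "g \<in> ideal_pow C I m"
  proof (rule ideal_powI[OF g])
    fix A p assume A: "A \<in> proj_pow C P m" and p: "p \<in> Hom C A Z"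
    \<comment> \<open>Since \<open>\<gamma>\<close> kills \<open>A\<close>, the map \<open>p\<close> lifts to \<open>Y\<close>, where \<open>f1\<close> kills it.\<close>
    have "\<gamma> \<cdot> p = Zero C A (Susp C X)"
      using ideal_pow_kills[OF ideal_pow_precomp[OF p \<gamma> T(3)] comp_hom[OF p T(3)] A] .
    then obtain y where y: "y \<in> Hom C A Y" "p = \<beta> \<cdot> y"
      using triangle_lift[OF rotate[OF t] p] by blast
    have "g \<cdot> p = f1 \<cdot> y"
      unfolding y(2) g_eq by (rule comp_assoc[OF y(1) T(2) g, symmetric])
    also have "\<dots> = Zero C A V"
      using ideal_pow_kills[OF ideal_pow_precomp[OF y(1) f1m f1(2)] comp_hom[OF y(1) f1(2)] A] .
    finally show "g \<cdot> p = Zero C A V" .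
  qed
  have "f2 \<cdot> g \<in> ideal_pow C I l"
    using ideal_pow_addI[OF gm g f2] \<open>m \<le> l\<close> by simp
  then have "f2 \<cdot> g = Zero C Z W"
    by (rule ideal_pow_kills[OF _ comp_hom[OF g f2(2)] Z])
  then have "(f2 \<cdot> g) \<cdot> \<beta> = Zero C Y W"
    using zero_comp[OF T(2)] HomD[OF fH] by simp
  then show "f = Zero C Y W"
    unfolding f_eq g_eq by (simp only: comp_assoc[OF T(2) g f2(2)])
qed

end

lemma len_eq_enatD:
  assumes "len C P X = enat n"
  shows "X \<in> proj_pow C P n"
proof -
  let ?S = "enat ` {n. X \<in> proj_pow C P n}"
  have "?S \<noteq> {}"
  proof
    assume "?S = {}"
    then show False
      using assms by (simp only: len_def Inf_enat_def) simp
  qed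
  then have "Inf ?S \<in> ?S"
    by (metis Inf_enat_def LeastI ex_in_conv)
  then show ?thesis
    using assms by (auto simp: len_def)
qed

lemma len_le: "X \<in> proj_pow C P n \<Longrightarrow> len C P X \<le> enat n"
  unfolding len_def by (rule INF_lower) simp

theorem lemma3p1:
  fixes T :: "('o, 'm, 'x) tri_category_scheme"
    and P :: "'o set" and I :: "'m set"
    and X Y Z :: 'o and \<alpha> \<beta> \<gamma> :: 'm
    and k l m n :: nat
  assumes "triangulated_category T"
    and "projective_class T P I"
    and "dist_triangle T X Y Z \<alpha> \<beta> \<gamma>"
    and "len T P X = enat k"
    and "len T P Y = enat n"
    and "len T P Z = enat l"
    and "\<gamma> \<in> ideal_pow T I m"
    and "m \<le> l"
  shows "int n \<le> max (int k - int m + int l) (int l)"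
proof -
  interpret projective_class T P I by fact
  have "Y \<in> proj_pow T P (max k m + (l - m))"
    using middle_proj_pow assms(3,7,8) len_eq_enatD[OF assms(4)] len_eq_enatD[OF assms(6)] by blast
  then have "n \<le> max k m + (l - m)"
    using len_le[of Y T P] assms(5) by fastforce
  then show ?thesis
    using assms(8) by linarith
qed

end
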